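(* The three-stage third-order explicit Runge--Kutta method with non-decreasing abscissas for $u_t=F(u)$ given by $$\begin{aligned} u^{(1)}&=\tfrac12u^n+\tfrac12\left(u^n+\tfrac43\Delta t\,F(u^n)\right),\\ u^{(2)}&=\tfrac23u^n+\tfrac13\left(u^{(1)}+\tfrac43\Delta t\,F(u^{(1)})\right),\\ u^{n+1}&=\tfrac{59}{128}u^n+\tfrac{15}{128}\left(u^n+\tfrac43\Delta t\,F(u^n)\right)+\tfrac{27}{64}\left(u^{(2)}+\tfrac43\Delta t\,F(u^{(2)})\right) \end{aligned}$$ is strong stability preserving with SSP coefficient $\mathcal{C}=\frac34$, and it is optimal among all eSSPRK$^+$(3,3) methods; that is, no eSSPRK$^+$(3,3) method has SSP coefficient larger than $\frac34$.
   Context: An explicit $s$-stage Runge--Kutta method for an ODE system $u_t=F(u)$ in Shu--Osher form is $$u^{(0)}=u^n,\quad u^{(i)}=\sum_{j=0}^{i-1}\left(\alpha_{ij}u^{(j)}+\Delta t\,\beta_{ij}F(u^{(j)})\right)\ (i=1,\dots,s),\quad u^{n+1}=u^{(s)},\qquad \sum_{j=0}^{i-1}\alpha_{ij}=1.$$ A given method may have many Shu--Osher representations. If all $\alpha_{ij},\beta_{ij}\ge0$ and $\alpha_{ij}=0$ only if $\beta_{ij}=0$, the representation is a convex combination of forward Euler steps and has the coefficient $\min_{i,j}\alpha_{ij}/\beta_{ij}$ (ratios with $\beta_{ij}=0$ are considered infinite). The SSP coefficient $\mathcal{C}$ of a method is the largest value of this coefficient over all such representations of the method; the method is called strong stability preserving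 (SSP) if $\mathcal{C}>0$. The Butcher form of a method with $s=3$ is $y_1=u^n$, $y_2=u^n+\Delta t\,a_{21}F(y_1)$, $y_3=u^n+\Delta t\,(a_{31}F(y_1)+a_{32}F(y_2))$, $u^{n+1}=u^n+\Delta t\,(b_1F(y_1)+b_2F(y_2)+b_3F(y_3))$, where $y_1,y_2,y_3$ are the Shu--Osher stages $u^{(0)},u^{(1)},u^{(2)}$; thus $a_{21}=\beta_{10}$, $a_{31}=\beta_{20}+\alpha_{21}\beta_{10}$, $a_{32}=\beta_{21}$, $b_1=\alpha_{32}\alpha_{21}\beta_{10}+\alpha_{31}\beta_{10}+\alpha_{32}\beta_{20}+\beta_{30}$, $b_2=\alpha_{32}\beta_{21}+\beta_{31}$, $b_3=\beta_{32}$. The abscissas are $c_1=0$, $c_2=a_{21}$, $c_3=a_{31}+a_{32}$. The method has order three if $$b_1+b_2+b_3=1,\quad b_2c_2+b_3c_3=\tfrac12,\quad b_2c_2^2+b_3c_3^2=\tfrac13,\quad b_3a_{32}c_2=\tfrac16.$$ An eSSPRK$^+$(3,3) method is an explicit SSP Runge--Kutta method with three stages, of order three, whose abscissas are non-decreasing: $c_1\le c_2\le c_3$. *)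

theory Defs
  imports "HOL-Library.Extended_Real"
begin

text \<open>
  A coefficient array \<open>\<alpha>\<close> (or \<open>\<beta>\<close>) of an \<open>s\<close>-stage Shu--Osher form is a function
  \<open>nat \<Rightarrow> nat \<Rightarrow> real\<close>, of which only the entries \<open>\<alpha> i j\<close> with \<open>1 \<le> i \<le> s\<close> and \<open>j < i\<close> matter.
\<close>

fun so_stage ::
  "(nat \<Rightarrow> nat \<Rightarrow> real) \<Rightarrow> (nat \<Rightarrow> nat \<Rightarrow> real) \<Rightarrow> real \<Rightarrow> ('a::real_vector \<Rightarrow> 'a) \<Rightarrow> 'a \<Rightarrow> nat \<Rightarrow> 'a"
where
  "so_stage \<alpha> \<beta> dt F u i =
     (if i = 0 then u
      else (\<Sum>j<i. \<alpha> i j *\<^sub>R so_stage \<alpha> \<beta> dt F u j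
                   + (dt * \<beta> i j) *\<^sub>R F (so_stage \<alpha> \<beta> dt F u j)))"

declare so_stage.simps [simp del]

definition so_consistent :: "nat \<Rightarrow> (nat \<Rightarrow> nat \<Rightarrow> real) \<Rightarrow> bool" where
  "so_consistent s \<alpha> \<longleftrightarrow> (\<forall>i\<in>{1..s}. (\<Sum>j<i. \<alpha> i j) = 1)"

text \<open>
  An explicit Runge--Kutta method is identified with its Butcher tableau. Indices start at 1;
  only \<open>rk_a M i j\<close> with \<open>1 \<le> j < i \<le> rk_stages M\<close> and \<open>rk_b M j\<close> with
  \<open>1 \<le> j \<le> rk_stages M\<close> matter.
\<close>

record rk_method =
  rk_stages :: nat
  rk_a :: "nat \<Rightarrow> nat \<Rightarrow> real"
  rk_b :: "nat \<Rightarrow> real"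

fun rk_stage :: "rk_method \<Rightarrow> real \<Rightarrow> ('a::real_vector \<Rightarrow> 'a) \<Rightarrow> 'a \<Rightarrow> nat \<Rightarrow> 'a" where
  "rk_stage M dt F u i = u + (\<Sum>j\<in>{1..<i}. (dt * rk_a M i j) *\<^sub>R F (rk_stage M dt F u j))"

declare rk_stage.simps [simp del]

definition rk_step :: "rk_method \<Rightarrow> real \<Rightarrow> ('a::real_vector \<Rightarrow> 'a) \<Rightarrow> 'a \<Rightarrow> 'a" where
  "rk_step M dt F u = u + (\<Sum>j\<in>{1..rk_stages M}. (dt * rk_b M j) *\<^sub>R F (rk_stage M dt F u j))"

definition rk_abscissa :: "rk_method \<Rightarrow> nat \<Rightarrow> real" where
  "rk_abscissa M i = (\<Sum>j\<in>{1..<i}. rk_a M i j)"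

text \<open>
  \<open>so_weight \<alpha> \<beta> i k\<close> is the coefficient of \<open>\<Delta>t F(u\<^bsup>(k)\<^esup>)\<close> in \<open>u\<^bsup>(i)\<^esup>\<close> once
  the stages \<open>u\<^bsup>(j)\<^esup>\<close> on the right-hand side of the Shu--Osher form have been eliminated.
\<close>

fun so_weight :: "(nat \<Rightarrow> nat \<Rightarrow> real) \<Rightarrow> (nat \<Rightarrow> nat \<Rightarrow> real) \<Rightarrow> nat \<Rightarrow> nat \<Rightarrow> real" where
  "so_weight \<alpha> \<beta> i k =
     (if k < i then \<beta> i k + (\<Sum>j<i. \<alpha> i j * so_weight \<alpha> \<beta> j k) else 0)"

declare so_weight.simps [simp del]

definition so_method :: "nat \<Rightarrow> (nat \<Rightarrow> nat \<Rightarrow> real) \<Rightarrow> (nat \<Rightarrow> nat \<Rightarrow> real) \<Rightarrow> rk_method" where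
  "so_method s \<alpha> \<beta> =
     \<lparr> rk_stages = s,
       rk_a = (\<lambda>i j. so_weight \<alpha> \<beta> (i - 1) (j - 1)),
       rk_b = (\<lambda>j. so_weight \<alpha> \<beta> s (j - 1)) \<rparr>"

definition so_representation ::
  "rk_method \<Rightarrow> (nat \<Rightarrow> nat \<Rightarrow> real) \<Rightarrow> (nat \<Rightarrow> nat \<Rightarrow> real) \<Rightarrow> bool" where
  "so_representation M \<alpha> \<beta> \<longleftrightarrow>
     so_consistent (rk_stages M) \<alpha> \<and>
     (\<forall>i\<in>{1..rk_stages M}. \<forall>j\<in>{1..<i}. rk_a M i j = rk_a (so_method (rk_stages M) \<alpha> \<beta>) i j) \<and>
     (\<forall>j\<in>{1..rk_stages M}. rk_b M j = rk_b (so_method (rk_stages M) \<alpha> \<beta>) j)"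

definition so_convex ::
  "nat \<Rightarrow> (nat \<Rightarrow> nat \<Rightarrow> real) \<Rightarrow> (nat \<Rightarrow> nat \<Rightarrow> real) \<Rightarrow> bool" where
  "so_convex s \<alpha> \<beta> \<longleftrightarrow>
     (\<forall>i\<in>{1..s}. \<forall>j<i. \<alpha> i j \<ge> 0 \<and> \<beta> i j \<ge> 0 \<and> (\<alpha> i j = 0 \<longrightarrow> \<beta> i j = 0))"

definition so_coefficient ::
  "nat \<Rightarrow> (nat \<Rightarrow> nat \<Rightarrow> real) \<Rightarrow> (nat \<Rightarrow> nat \<Rightarrow> real) \<Rightarrow> ereal" where
  "so_coefficient s \<alpha> \<beta> =
     (MIN i\<in>{1..s}. MIN j\<in>{..<i}. if \<beta> i j = 0 then \<infinity> else ereal (\<alpha> i j / \<beta> i j))"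

text \<open>
  If \<open>M\<close> has no representation by convex combinations of forward Euler steps, the supremum is
  \<open>-\<infinity>\<close>, so \<open>M\<close> is not strong stability preserving.
\<close>

definition ssp_coefficient :: "rk_method \<Rightarrow> ereal" where
  "ssp_coefficient M =
     Sup {so_coefficient (rk_stages M) \<alpha> \<beta> | \<alpha> \<beta>.
            so_representation M \<alpha> \<beta> \<and> so_convex (rk_stages M) \<alpha> \<beta>}"

definition is_ssp :: "rk_method \<Rightarrow> bool" where
  "is_ssp M \<longleftrightarrow> ssp_coefficient M > 0"

text \<open>The order conditions below are those of a three-stage method, where \<open>c\<^sub>1 = 0\<close>.\<close>

definition rk3_order_three :: "rk_method \<Rightarrow> bool" where
  "rk3_order_three M \<longleftrightarrow>
     (let b = rk_b M; c = rk_abscissa M in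
        b 1 + b 2 + b 3 = 1 \<and>
        b 2 * c 2 + b 3 * c 3 = 1/2 \<and>
        b 2 * (c 2)\<^sup>2 + b 3 * (c 3)\<^sup>2 = 1/3 \<and>
        b 3 * rk_a M 3 2 * c 2 = 1/6)"

definition eSSPRK_plus_3_3 :: "rk_method \<Rightarrow> bool" where
  "eSSPRK_plus_3_3 M \<longleftrightarrow>
     rk_stages M = 3 \<and> is_ssp M \<and> rk3_order_three M \<and>
     rk_abscissa M 1 \<le> rk_abscissa M 2 \<and> rk_abscissa M 2 \<le> rk_abscissa M 3"

definition opt_alpha :: "nat \<Rightarrow> nat \<Rightarrow> real" where
  "opt_alpha = (\<lambda>_ _. 0)
     (1 := (\<lambda>_. 0)(0 := 1/2 + 1/2),
      2 := (\<lambda>_. 0)(0 := 2/3, 1 := 1/3),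
      3 := (\<lambda>_. 0)(0 := 59/128 + 15/128, 2 := 27/64))"

definition opt_beta :: "nat \<Rightarrow> nat \<Rightarrow> real" where
  "opt_beta = (\<lambda>_ _. 0)
     (1 := (\<lambda>_. 0)(0 := 1/2 * (4/3)),
      2 := (\<lambda>_. 0)(1 := 1/3 * (4/3)),
      3 := (\<lambda>_. 0)(0 := 15/128 * (4/3), 2 := 27/64 * (4/3)))"

definition opt_method :: rk_method where
  "opt_method = so_method 3 opt_alpha opt_beta"

text \<open>Eliminating the stages gives the Butcher coefficients of a three-stage method.\<close>

lemma so_weight_3:
  "so_weight \<alpha> \<beta> 1 0 = \<beta> 1 0"
  "so_weight \<alpha> \<beta> 2 0 = \<beta> 2 0 + \<alpha> 2 1 * \<beta> 1 0"
  "so_weight \<alpha> \<beta> 2 1 = \<beta> 2 1"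
  "so_weight \<alpha> \<beta> 3 0 =
     \<alpha> 3 2 * \<alpha> 2 1 * \<beta> 1 0 + \<alpha> 3 1 * \<beta> 1 0 + \<alpha> 3 2 * \<beta> 2 0 + \<beta> 3 0"
  "so_weight \<alpha> \<beta> 3 1 = \<alpha> 3 2 * \<beta> 2 1 + \<beta> 3 1"
  "so_weight \<alpha> \<beta> 3 2 = \<beta> 3 2"
  by (simp_all add: so_weight.simps numeral_eq_Suc algebra_simps)

lemma so_stage_eq:
  assumes "so_consistent s \<alpha>" "i \<le> s"
  shows "so_stage \<alpha> \<beta> dt F u i =
           u + (\<Sum>k<i. (dt * so_weight \<alpha> \<beta> i k) *\<^sub>R F (so_stage \<alpha> \<beta> dt F u k))"
  using assms(2)
proof (induction i rule: less_induct)
  case (less i)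
  let ?u = "so_stage \<alpha> \<beta> dt F u" and ?w = "so_weight \<alpha> \<beta>"
  show ?case
  proof (cases "i = 0")
    case True
    then show ?thesis by (simp add: so_stage.simps)
  next
    case False
    have one: "(\<Sum>j<i. \<alpha> i j) = 1"
      using assms(1) False less.prems by (auto simp: so_consistent_def)
    have stage: "?u j = u + (\<Sum>k<i. (dt * ?w j k) *\<^sub>R F (?u k))" if "j < i" for j
    proof -
      have "?u j = u + (\<Sum>k<j. (dt * ?w j k) *\<^sub>R F (?u k))"
        using less.IH[OF that] that less.prems by simp
      also have "(\<Sum>k<j. (dt * ?w j k) *\<^sub>R F (?u k)) = (\<Sum>k<i. (dt * ?w j k) *\<^sub>R F (?u k))"
        by (rule sum.mono_neutral_left) (use that in \<open>auto simp: so_weight.simps[of _ _ j]\<close>)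
      finally show ?thesis .
    qed
    have "?u i = (\<Sum>j<i. \<alpha> i j *\<^sub>R ?u j) + (\<Sum>k<i. (dt * \<beta> i k) *\<^sub>R F (?u k))"
      using False by (simp add: so_stage.simps[of _ _ _ _ _ i] sum.distrib)
    also have "(\<Sum>j<i. \<alpha> i j *\<^sub>R ?u j) =
        (\<Sum>j<i. \<alpha> i j *\<^sub>R (u + (\<Sum>k<i. (dt * ?w j k) *\<^sub>R F (?u k))))"
      by (rule sum.cong) (auto simp flip: stage)
    also have "\<dots> = u + (\<Sum>j<i. \<Sum>k<i. (\<alpha> i j * (dt * ?w j k)) *\<^sub>R F (?u k))"
      by (simp add: scaleR_add_right sum.distrib scaleR_sum_right one flip: scaleR_sum_left)
    also have "(\<Sum>j<i. \<Sum>k<i. (\<alpha> i j * (dt * ?w j k)) *\<^sub>R F (?u k)) =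
        (\<Sum>k<i. (dt * (\<Sum>j<i. \<alpha> i j * ?w j k)) *\<^sub>R F (?u k))"
      by (subst sum.swap) (simp add: scaleR_sum_left sum_distrib_left mult_ac)
    also have "u + (\<Sum>k<i. (dt * (\<Sum>j<i. \<alpha> i j * ?w j k)) *\<^sub>R F (?u k)) +
        (\<Sum>k<i. (dt * \<beta> i k) *\<^sub>R F (?u k)) = u + (\<Sum>k<i. (dt * ?w i k) *\<^sub>R F (?u k))"
      by (simp add: so_weight.simps[of _ _ i] algebra_simps flip: sum.distrib)
    finally show ?thesis .
  qed
qed

text \<open>
  A representation of \<open>M\<close> has the stages of the Butcher form of \<open>M\<close>, shifted by one in the index,
  and the same final value.
\<close>

lemma so_representation_stage:
  assumes "so_representation M \<alpha> \<beta>" "i < rk_stages M"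
  shows "so_stage \<alpha> \<beta> dt F u i = rk_stage M dt F u (Suc i)"
  using assms(2)
proof (induction i rule: less_induct)
  case (less i)
  have "so_stage \<alpha> \<beta> dt F u i =
      u + (\<Sum>k<i. (dt * so_weight \<alpha> \<beta> i k) *\<^sub>R F (so_stage \<alpha> \<beta> dt F u k))"
    by (rule so_stage_eq[where s = "rk_stages M"])
       (use assms(1) less.prems in \<open>auto simp: so_representation_def\<close>)
  also have "\<dots> = u + (\<Sum>k<i. (dt * rk_a M (Suc i) (Suc k)) *\<^sub>R F (rk_stage M dt F u (Suc k)))"
    using assms(1) less by (simp add: so_representation_def so_method_def)
  also have "\<dots> = rk_stage M dt F u (Suc i)"
    unfolding rk_stage.simps[of _ _ _ _ "Suc i"]
    by (simp add: sum.atLeast_Suc_lessThan_Suc_shift lessThan_atLeast0 del: sum.op_ivl_Suc)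
  finally show ?case .
qed

lemma so_representation_step:
  assumes "so_representation M \<alpha> \<beta>"
  shows "so_stage \<alpha> \<beta> dt F u (rk_stages M) = rk_step M dt F u"
proof -
  let ?s = "rk_stages M"
  have "so_stage \<alpha> \<beta> dt F u ?s =
      u + (\<Sum>k<?s. (dt * so_weight \<alpha> \<beta> ?s k) *\<^sub>R F (so_stage \<alpha> \<beta> dt F u k))"
    by (rule so_stage_eq[where s = ?s]) (use assms in \<open>auto simp: so_representation_def\<close>)
  also have "\<dots> = u + (\<Sum>k<?s. (dt * rk_b M (Suc k)) *\<^sub>R F (rk_stage M dt F u (Suc k)))"
    using assms by (simp add: so_representation_stage) (simp add: so_representation_def so_method_def)
  also have "\<dots> = rk_step M dt F u"
    by (simp add: rk_step_def sum.atLeast1_atMost_eq)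
  finally show ?thesis .
qed

end

theory Submission
  imports Defs
begin

text \<open>
  If \<open>r\<close> is the coefficient of a representation, then \<open>a\<^sub>3\<^sub>1 \<ge> r a\<^sub>3\<^sub>2 c\<^sub>2\<close> and \<open>b\<^sub>2 \<ge> r b\<^sub>3 a\<^sub>3\<^sub>2\<close>.
  Since \<open>b\<^sub>3 a\<^sub>3\<^sub>2 c\<^sub>2 = 1/6\<close>, this gives \<open>b\<^sub>2 c\<^sub>2 \<ge> r/6\<close> and \<open>b\<^sub>3 c\<^sub>3 \<ge> 1/(6 c\<^sub>2) + r/6\<close>, so the
  second order condition implies \<open>2 r \<le> 3 - 1/c\<^sub>2\<close>. Monotone abscissas and the second and third
  order conditions yield \<open>1/3 \<ge> c\<^sub>2/2\<close>, that is \<open>c\<^sub>2 \<le> 2/3\<close>, and hence \<open>r \<le> 3/4\<close>.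
\<close>

text \<open>Clearing the denominator absorbs the ratios that count as infinite: where
  \<open>\<beta> i j = 0\<close>, only \<open>0 \<le> \<alpha> i j\<close> is left to check.\<close>

lemma so_coefficient_mult_le:
  assumes "so_convex s \<alpha> \<beta>" "ereal r \<le> so_coefficient s \<alpha> \<beta>" "i \<in> {1..s}" "j < i"
  shows "r * \<beta> i j \<le> \<alpha> i j"
proof (cases "\<beta> i j = 0")
  case True
  then show ?thesis using assms by (auto simp: so_convex_def)
next
  case False
  have "so_coefficient s \<alpha> \<beta> \<le>
      (MIN j\<in>{..<i}. if \<beta> i j = 0 then \<infinity> else ereal (\<alpha> i j / \<beta> i j))"
    unfolding so_coefficient_def by (rule Min_le) (use assms(3) in auto)
  also have "\<dots> \<le> (if \<beta> i j = 0 then \<infinity> else ereal (\<alpha> i j / \<beta> i j))"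
    by (rule Min_le) (use assms(4) in auto)
  finally have "r \<le> \<alpha> i j / \<beta> i j" using assms(2) False order_trans by fastforce
  moreover have "0 < \<beta> i j" using assms False by (force simp: so_convex_def order_less_le)
  ultimately show ?thesis by (simp add: pos_le_divide_eq)
qed

lemma order_three_bound:
  fixes a21 a31 a32 b2 b3 r :: real
  defines "c \<equiv> a21" and "e \<equiv> a31 + a32"
  assumes nonneg: "0 \<le> c" "0 \<le> b2" "0 \<le> b3"
    and mono: "c \<le> e"
    and a31: "r * a32 * c \<le> a31"
    and b2: "r * b3 * a32 \<le> b2"
    and ord2: "b2 * c + b3 * e = 1/2"
    and ord3: "b2 * c\<^sup>2 + b3 * e\<^sup>2 = 1/3" "b3 * a32 * c = 1/6"
  shows "r \<le> 3/4"
proof -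
  have c: "0 < c" using nonneg ord3(2) by (cases "c = 0") auto
  \<comment> \<open>Subtracting \<open>c\<close> times the second condition from the third cancels
    the \<open>b2\<close> terms and leaves this product, so 1/3 - c/2 is nonnegative.\<close>
  have "0 \<le> b3 * e * (e - c)" using nonneg mono by simp
  moreover have "b3 * e * (e - c) = (b2 * c\<^sup>2 + b3 * e\<^sup>2) - c * (b2 * c + b3 * e)"
    by (simp add: algebra_simps power2_eq_square)
  ultimately have "c \<le> 2/3" unfolding ord2 ord3 by simp
  have "r * (b3 * a32 * c) \<le> b2 * c"
    using mult_right_mono[OF b2, of c] nonneg by (simp add: mult_ac)
  then have 1: "r / 6 \<le> b2 * c" using ord3(2) by simp
  have "r * (b3 * a32 * c) \<le> b3 * a31"
    using mult_left_mono[OF a31, of b3] nonneg by (simp add: mult_ac)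
  then have "r / 6 + b3 * a32 \<le> b3 * e" unfolding ord3(2) e_def by (simp add: algebra_simps)
  with 1 ord2 have "b3 * a32 \<le> 1/2 - r/3" by simp
  then have "1/6 \<le> (1/2 - r/3) * c"
    using mult_right_mono[of "b3 * a32" _ c] ord3(2) c by fastforce
  \<comment> \<open>The factor must be positive before \<open>c\<close> can be replaced by its upper
    bound 2/3; it is, since its product with \<open>c > 0\<close> is at least 1/6.\<close>
  moreover from this have "0 < 1/2 - r/3"
    using c by (smt (verit) divide_pos_pos mult_nonpos_nonneg)
  ultimately have "1/6 \<le> (1/2 - r/3) * (2/3)"
    using mult_left_mono[OF \<open>c \<le> 2/3\<close>, of "1/2 - r/3"] by simp
  then show ?thesis by simp
qed

lemma rk_abscissa_1_2_3:
  "rk_abscissa M 1 = 0" "rk_abscissa M 2 = rk_a M 2 1" "rk_abscissa M 3 = rk_a M 3 1 + rk_a M 3 2"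
proof -
  have "{1..<2} = {1::nat}" "{1..<3} = {1, 2::nat}" by auto
  then show "rk_abscissa M 1 = 0" "rk_abscissa M 2 = rk_a M 2 1"
    "rk_abscissa M 3 = rk_a M 3 1 + rk_a M 3 2"
    by (simp_all add: rk_abscissa_def)
qed

lemma so_coefficient_le:
  assumes "rk_stages M = 3" "rk3_order_three M" "rk_abscissa M 2 \<le> rk_abscissa M 3"
    and rep: "so_representation M \<alpha> \<beta>" and conv: "so_convex 3 \<alpha> \<beta>"
  shows "so_coefficient 3 \<alpha> \<beta> \<le> ereal (3/4)"
\<comment> \<open>A priori the coefficient may be infinite, so the bound is shown for every value
  strictly below it; the only nontrivial case is a real \<open>r\<close>.\<close>
proof (rule dense_le)
  fix x assume x: "x < so_coefficient 3 \<alpha> \<beta>"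
  show "x \<le> ereal (3/4)"
  proof (cases x)
    case (real r)
    have le: "r * \<beta> i j \<le> \<alpha> i j" if "i \<in> {1..3}" "j < i" for i j
      by (rule so_coefficient_mult_le[OF conv _ that]) (use x real in simp)
    have pos: "0 \<le> \<alpha> i j" "0 \<le> \<beta> i j" if "i \<in> {1..3}" "j < i" for i j
      using conv that by (auto simp: so_convex_def)
    have a: "rk_a M 2 1 = \<beta> 1 0" "rk_a M 3 1 = \<beta> 2 0 + \<alpha> 2 1 * \<beta> 1 0" "rk_a M 3 2 = \<beta> 2 1"
      and b: "rk_b M 2 = \<alpha> 3 2 * \<beta> 2 1 + \<beta> 3 1" "rk_b M 3 = \<beta> 3 2"
      using rep assms(1) so_weight_3[of \<alpha> \<beta>] by (auto simp: so_representation_def so_method_def)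
    have "r \<le> 3/4"
    proof (rule order_three_bound)
      \<comment> \<open>Multiply \<open>r * \<beta> 2 1 \<le> \<alpha> 2 1\<close> by
        \<open>\<beta> 1 0\<close> and add \<open>\<beta> 2 0 \<ge> 0\<close>. The next inequality
        arises likewise from the entry (3,2), multiplied by \<open>\<beta> 2 1\<close>, with
        \<open>\<beta> 3 1 \<ge> 0\<close> added.\<close>
      show "r * rk_a M 3 2 * rk_a M 2 1 \<le> rk_a M 3 1"
        using mult_right_mono[OF le[of 2 1] pos(2)[of 1 0]] pos(2)[of 2 0]
        unfolding a by simp
      show "r * rk_b M 3 * rk_a M 3 2 \<le> rk_b M 2"
        using mult_right_mono[OF le[of 3 2] pos(2)[of 2 1]] pos(2)[of 3 1]
        unfolding a b by (simp add: algebra_simps)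
      show "0 \<le> rk_a M 2 1" "0 \<le> rk_b M 2" "0 \<le> rk_b M 3"
        unfolding a b using pos by simp_all
    qed (use assms(2,3) in \<open>simp_all add: rk_abscissa_1_2_3 rk3_order_three_def Let_def\<close>)
    then show ?thesis using real by simp
  qed (use x in auto)
qed

lemma ssp_coefficient_le:
  assumes "rk_stages M = 3" "rk3_order_three M" "rk_abscissa M 2 \<le> rk_abscissa M 3"
  shows "ssp_coefficient M \<le> ereal (3/4)"
  unfolding ssp_coefficient_def by (rule Sup_least) (use assms so_coefficient_le in auto)

lemma numeral_intervals:
  "{Suc 0..3} = {Suc 0, 2, 3}" "{..<Suc 0} = {0}" "{..<2} = {0, Suc 0}" "{..<3} = {0, Suc 0, 2}"
  by auto

lemma opt_coeffs:
  "opt_alpha (Suc 0) 0 = 1"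
  "opt_alpha 2 0 = 2/3" "opt_alpha 2 (Suc 0) = 1/3"
  "opt_alpha 3 0 = 37/64" "opt_alpha 3 (Suc 0) = 0" "opt_alpha 3 2 = 27/64"
  "opt_beta (Suc 0) 0 = 2/3"
  "opt_beta 2 0 = 0" "opt_beta 2 (Suc 0) = 4/9"
  "opt_beta 3 0 = 5/32" "opt_beta 3 (Suc 0) = 0" "opt_beta 3 2 = 9/16"
  by (simp_all add: opt_alpha_def opt_beta_def)

lemma so_consistent_opt: "so_consistent 3 opt_alpha"
  by (simp add: so_consistent_def numeral_intervals opt_alpha_def)

lemma so_representation_opt: "so_representation opt_method opt_alpha opt_beta"
  using so_consistent_opt by (simp add: so_representation_def opt_method_def so_method_def)

lemma so_convex_opt: "so_convex 3 opt_alpha opt_beta"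
  by (auto simp: so_convex_def numeral_intervals opt_alpha_def opt_beta_def)

text \<open>The finite ratios are 3/2, 3/4, 37/10 and 3/4. The minimum sits at the entries (2,1) and
  (3,2), the two whose ratios enter the upper bound.\<close>

lemma so_coefficient_opt: "so_coefficient 3 opt_alpha opt_beta = ereal (3/4)"
  by (simp add: so_coefficient_def numeral_intervals opt_coeffs min_def)

text \<open>With \<open>r = 3/4\<close> these values turn the hypotheses \<open>mono\<close>,
  \<open>a31\<close> and \<open>b2\<close> of \<open>order_three_bound\<close> into equalities: c2 =
  c3 = 2/3, 2/9 = 3/4 * 4/9 * 2/3 and 3/16 = 3/4 * 9/16 * 4/9.\<close>

lemma opt_tableau:
  "rk_a opt_method 2 1 = 2/3" "rk_a opt_method 3 1 = 2/9" "rk_a opt_method 3 2 = 4/9"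
  "rk_b opt_method 1 = 1/4" "rk_b opt_method 2 = 3/16" "rk_b opt_method 3 = 9/16"
  using so_weight_3[of opt_alpha opt_beta]
  by (simp_all add: opt_method_def so_method_def opt_coeffs)

lemma rk_abscissa_opt:
  "rk_abscissa opt_method 1 = 0" "rk_abscissa opt_method 2 = 2/3" "rk_abscissa opt_method 3 = 2/3"
  unfolding rk_abscissa_1_2_3 opt_tableau by simp_all

lemma rk3_order_three_opt: "rk3_order_three opt_method"
  unfolding rk3_order_three_def Let_def rk_abscissa_opt opt_tableau
  by (simp add: power2_eq_square)

lemma rk_stages_opt: "rk_stages opt_method = 3"
  by (simp add: opt_method_def so_method_def)

text \<open>The general bound gives one direction; the given representation attains it, so the
  supremum is a maximum.\<close>

lemma ssp_coefficient_opt: "ssp_coefficient opt_method = ereal (3/4)"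
proof (rule antisym)
  show "ssp_coefficient opt_method \<le> ereal (3/4)"
    by (rule ssp_coefficient_le)
      (simp_all add: rk_stages_opt rk3_order_three_opt rk_abscissa_opt)
  show "ereal (3/4) \<le> ssp_coefficient opt_method"
    unfolding ssp_coefficient_def rk_stages_opt so_coefficient_opt[symmetric]
    by (rule Sup_upper) (use so_representation_opt so_convex_opt in auto)
qed

lemma eSSPRK_plus_3_3_opt: "eSSPRK_plus_3_3 opt_method"
  unfolding eSSPRK_plus_3_3_def is_ssp_def ssp_coefficient_opt rk_abscissa_opt
  by (simp add: rk_stages_opt rk3_order_three_opt)

theorem theorem3:
  fixes F :: "'a::real_vector \<Rightarrow> 'a" and dt :: real and u :: 'a
  shows
    "(let u0 = so_stage opt_alpha opt_beta dt F u 0;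
          u1 = so_stage opt_alpha opt_beta dt F u 1;
          u2 = so_stage opt_alpha opt_beta dt F u 2;
          u3 = so_stage opt_alpha opt_beta dt F u 3 in
        u0 = u \<and>
        u1 = (1/2) *\<^sub>R u + (1/2) *\<^sub>R (u + (4/3 * dt) *\<^sub>R F u) \<and>
        u2 = (2/3) *\<^sub>R u + (1/3) *\<^sub>R (u1 + (4/3 * dt) *\<^sub>R F u1) \<and>
        u3 = (59/128) *\<^sub>R u + (15/128) *\<^sub>R (u + (4/3 * dt) *\<^sub>R F u)
               + (27/64) *\<^sub>R (u2 + (4/3 * dt) *\<^sub>R F u2) \<and>
        rk_step opt_method dt F u = u3)
     \<and> eSSPRK_plus_3_3 opt_method
     \<and> so_representation opt_method opt_alpha opt_beta
     \<and> so_convex 3 opt_alpha opt_beta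
     \<and> so_coefficient 3 opt_alpha opt_beta = ereal (3/4)
     \<and> ssp_coefficient opt_method = ereal (3/4)
     \<and> (\<forall>M. eSSPRK_plus_3_3 M \<longrightarrow> ssp_coefficient M \<le> ereal (3/4))"
proof -
  let ?u = "so_stage opt_alpha opt_beta dt F u"
  have u0: "?u 0 = u" by (simp add: so_stage.simps)
  have u1: "?u 1 = (1/2) *\<^sub>R u + (1/2) *\<^sub>R (u + (4/3 * dt) *\<^sub>R F u)"
    unfolding so_stage.simps[of _ _ _ _ _ 1]
    by (simp add: numeral_intervals u0 opt_coeffs scaleR_add_right
        flip: add.assoc scaleR_add_left)
  have u2: "?u 2 = (2/3) *\<^sub>R u + (1/3) *\<^sub>R (?u 1 + (4/3 * dt) *\<^sub>R F (?u 1))"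
    unfolding so_stage.simps[of _ _ _ _ _ 2]
    by (simp add: numeral_intervals u0 opt_coeffs algebra_simps)
  \<comment> \<open>The free term and the Euler step both start from \<open>u\<close>, so their
    weights merge: 59/128 + 15/128 = 37/64 is \<open>opt_alpha 3 0\<close>, and 15/128 * 4/3 = 5/32
    is \<open>opt_beta 3 0\<close>.\<close>
  have u3: "?u 3 = (59/128) *\<^sub>R u + (15/128) *\<^sub>R (u + (4/3 * dt) *\<^sub>R F u)
      + (27/64) *\<^sub>R (?u 2 + (4/3 * dt) *\<^sub>R F (?u 2))"
    unfolding so_stage.simps[of _ _ _ _ _ 3]
    by (simp add: numeral_intervals u0 opt_coeffs scaleR_add_right mult.commute[of _ dt]
        flip: add.assoc scaleR_add_left)
  have "rk_step opt_method dt F u = ?u 3"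
    using so_representation_step[OF so_representation_opt, of dt F u] by (simp add: rk_stages_opt)
  moreover have "\<forall>M. eSSPRK_plus_3_3 M \<longrightarrow> ssp_coefficient M \<le> ereal (3/4)"
    by (simp add: eSSPRK_plus_3_3_def ssp_coefficient_le)
  ultimately show ?thesis
    unfolding Let_def
    using u0 u1 u2 u3 eSSPRK_plus_3_3_opt so_representation_opt so_convex_opt so_coefficient_opt
      ssp_coefficient_opt
    by blast
qed

end
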